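(* In the multiple group random coefficient regression model, the $A$-criterion for the prediction of the individual treatment effects is given, for an approximate design with treatment group weight $w\in\left(0,\frac1{J-1}\right)$, by $$\mathrm{A}_{\Psi}(w)=\sigma^2(J-1)\left(\frac{K(v+u)+1}{Kw}+\frac{Ku+1}{K(1-(J-1)w)}+v\left(N-2-\frac{Kv\,(Nw-1)}{K(v+u)+1}\right)\right).$$
   Context: Model. Let $J\ge 2$, $N,K,n\ge 1$ be integers with $m:=N-(J-1)n\ge 1$, and let $\sigma^2,u,v>0$ be given reals. Put $N_0=0$, $N_j=jn$ for $j=1,\dots,J-1$, and $N_J=N$. Group $j$ consists of individuals $i=N_{j-1}+1,\dots,N_j$. For $k=1,\dots,K$ one observes $Y_{jik}=\mu_i+\alpha_{ji}+\varepsilon_{jik}$ for $i$ in treatment group $j\le J-1$, and $Y_{Jik}=\mu_i+\varepsilon_{Jik}$ for $i$ in the control group $J$. The random variables $\mu_i$ and $\alpha_{ji}$ (defined for all $i=1,\dots,N$ and all $j=1,\dots,J-1$, whatever the group of $i$) and the errors $\varepsilon_{jik}$ are all pairwise uncorrelated, with $\mathrm{E}(\mu_i)=\mu$, $\mathrm{E}(\alpha_{ji})=\alpha_j$ (unknown), $\mathrm{var}(\mu_i)=u\sigma^2$, $\mathrm{var}(\alpha_{ji})=v\sigma^2$, $\mathrm{E}(\varepsilon_{jik})=0$, $\mathrm{var}(\varepsilon_{jik})=\sigma^2$. Criterion. Let $\Psi_i=(\alpha_{1i},\dots,\alpha_{J-1\,i})^\top$, $\Psi=(\Psi_1^\top,\dots,\Psi_N^\top)^\top$,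 and let $\hat\Psi$ be the best linear unbiased predictor (BLUP) of $\Psi$: componentwise, the predictor linear in the observations, unbiased for all values of $\mu,\alpha_1,\dots,\alpha_{J-1}$, and with minimal mean squared prediction error. The $A$-criterion of an exact design is $\mathrm{A}_\Psi=\mathrm{tr}\left(\mathrm{Cov}(\hat\Psi-\Psi)\right)$, as a function of $n$ and $m$. For an approximate design (weight $w=n/N$ for each treatment group and $1-(J-1)w=m/N$ for the control group, $w\in(0,1/(J-1))$ real), $\mathrm{A}_\Psi(w)$ is the function obtained from this expression by substituting $n=Nw$ and $m=N(1-(J-1)w)$; in particular for $w=n/N$ it equals the trace for the exact design. *)

theory Defs
  imports "HOL-Probability.Probability" "HOL-Computational_Algebra.Polynomial"
begin

text \<open>Individuals and groups are numbered from 1, as are the replications. The individuals of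
  group \<open>j\<close> are \<open>N\<^sub>j\<^sub>-\<^sub>1 + 1, \<dots>, N\<^sub>j\<close> with \<open>N\<^sub>j = group_end J N n j\<close>; group \<open>J\<close> is the control group.\<close>

definition group_end :: "nat \<Rightarrow> nat \<Rightarrow> nat \<Rightarrow> nat \<Rightarrow> nat" where
  "group_end J N n j = (if j = J then N else j * n)"

definition group :: "nat \<Rightarrow> nat \<Rightarrow> nat \<Rightarrow> nat \<Rightarrow> nat set" where
  "group J N n j = {group_end J N n (j - 1) + 1 .. group_end J N n j}"

text \<open>The observation labels \<open>(j, i, k)\<close>: replication \<open>k\<close> for individual \<open>i\<close> of group \<open>j\<close>.\<close>

definition obs :: "nat \<Rightarrow> nat \<Rightarrow> nat \<Rightarrow> nat \<Rightarrow> (nat \<times> nat \<times> nat) set" where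
  "obs J N K n = {(j, i, k). j \<in> {1..J} \<and> i \<in> group J N n j \<and> k \<in> {1..K}}"

text \<open>Names of the unobservable random variables: \<open>Mu i\<close> is \<open>\<mu>\<^sub>i\<close>, \<open>Alpha j i\<close> is \<open>\<alpha>\<^sub>j\<^sub>i\<close> and
  \<open>Eps j i k\<close> is \<open>\<epsilon>\<^sub>j\<^sub>i\<^sub>k\<close>.\<close>

datatype latent = Mu nat | Alpha nat nat | Eps nat nat nat

definition latents :: "nat \<Rightarrow> nat \<Rightarrow> nat \<Rightarrow> nat \<Rightarrow> latent set" where
  "latents J N K n = Mu ` {1..N} \<union> {Alpha j i | j i. j \<in> {1..J-1} \<and> i \<in> {1..N}}
     \<union> {Eps j i k | j i k. (j, i, k) \<in> obs J N K n}"

definition covariance :: "'a measure \<Rightarrow> ('a \<Rightarrow> real) \<Rightarrow> ('a \<Rightarrow> real) \<Rightarrow> real" where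
  "covariance M X Y =
     integral\<^sup>L M (\<lambda>x. (X x - integral\<^sup>L M X) * (Y x - integral\<^sup>L M Y))"

text \<open>The fixed effects are unknown, so the model is a family of probability measures
  \<open>P \<mu> a\<close> on one sample space, indexed by \<open>\<mu>\<close> and by \<open>a j = \<alpha>\<^sub>j\<close> for \<open>1 \<le> j \<le> J - 1\<close>
  (other values of \<open>a\<close> play no role). The parameter \<open>s2\<close> is \<open>\<sigma>\<^sup>2\<close>.\<close>

locale multiple_group_rcr =
  fixes J N K n :: nat and s2 u v :: real
    and P :: "real \<Rightarrow> (nat \<Rightarrow> real) \<Rightarrow> 'a measure"
    and X :: "latent \<Rightarrow> 'a \<Rightarrow> real"
  assumes J_ge_2: "J \<ge> 2" and K_ge_1: "K \<ge> 1" and n_ge_1: "n \<ge> 1"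
    and control_nonempty: "(J - 1) * n < N"
    and s2_pos: "s2 > 0" and u_pos: "u > 0" and v_pos: "v > 0"
    and prob: "\<And>\<mu> a. prob_space (P \<mu> a)"
    and measurable: "\<And>\<mu> a r. r \<in> latents J N K n \<Longrightarrow> X r \<in> borel_measurable (P \<mu> a)"
    and square_integrable:
      "\<And>\<mu> a r. r \<in> latents J N K n \<Longrightarrow> integrable (P \<mu> a) (\<lambda>x. (X r x)\<^sup>2)"
    and uncorrelated:
      "\<And>\<mu> a r s. r \<in> latents J N K n \<Longrightarrow> s \<in> latents J N K n \<Longrightarrow> r \<noteq> s \<Longrightarrow>
         covariance (P \<mu> a) (X r) (X s) = 0"
    and mean_Mu: "\<And>\<mu> a i. Mu i \<in> latents J N K n \<Longrightarrow> integral\<^sup>L (P \<mu> a) (X (Mu i)) = \<mu>"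
    and mean_Alpha:
      "\<And>\<mu> a j i. Alpha j i \<in> latents J N K n \<Longrightarrow> integral\<^sup>L (P \<mu> a) (X (Alpha j i)) = a j"
    and mean_Eps:
      "\<And>\<mu> a j i k. Eps j i k \<in> latents J N K n \<Longrightarrow> integral\<^sup>L (P \<mu> a) (X (Eps j i k)) = 0"
    and var_Mu: "\<And>\<mu> a i. Mu i \<in> latents J N K n \<Longrightarrow>
         covariance (P \<mu> a) (X (Mu i)) (X (Mu i)) = u * s2"
    and var_Alpha: "\<And>\<mu> a j i. Alpha j i \<in> latents J N K n \<Longrightarrow>
         covariance (P \<mu> a) (X (Alpha j i)) (X (Alpha j i)) = v * s2"
    and var_Eps: "\<And>\<mu> a j i k. Eps j i k \<in> latents J N K n \<Longrightarrow>
         covariance (P \<mu> a) (X (Eps j i k)) (X (Eps j i k)) = s2"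

definition Y :: "nat \<Rightarrow> (latent \<Rightarrow> 'a \<Rightarrow> real) \<Rightarrow> nat \<times> nat \<times> nat \<Rightarrow> 'a \<Rightarrow> real" where
  "Y J X = (\<lambda>(j, i, k) x.
     if j < J then X (Mu i) x + X (Alpha j i) x + X (Eps j i k) x
     else X (Mu i) x + X (Eps j i k) x)"

definition linear_predictor ::
  "nat \<Rightarrow> nat \<Rightarrow> nat \<Rightarrow> nat \<Rightarrow> (latent \<Rightarrow> 'a \<Rightarrow> real) \<Rightarrow> ('a \<Rightarrow> real) \<Rightarrow> bool" where
  "linear_predictor J N K n X Z \<longleftrightarrow>
     (\<exists>c :: nat \<times> nat \<times> nat \<Rightarrow> real. Z = (\<lambda>x. \<Sum>q\<in>obs J N K n. c q * Y J X q x))"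

definition unbiased_predictor ::
  "(real \<Rightarrow> (nat \<Rightarrow> real) \<Rightarrow> 'a measure) \<Rightarrow> ('a \<Rightarrow> real) \<Rightarrow> ('a \<Rightarrow> real) \<Rightarrow> bool" where
  "unbiased_predictor P T Z \<longleftrightarrow> (\<forall>\<mu> a. integral\<^sup>L (P \<mu> a) Z = integral\<^sup>L (P \<mu> a) T)"

definition is_BLUP ::
  "nat \<Rightarrow> nat \<Rightarrow> nat \<Rightarrow> nat \<Rightarrow> (real \<Rightarrow> (nat \<Rightarrow> real) \<Rightarrow> 'a measure) \<Rightarrow> (latent \<Rightarrow> 'a \<Rightarrow> real) \<Rightarrow>
     ('a \<Rightarrow> real) \<Rightarrow> ('a \<Rightarrow> real) \<Rightarrow> bool" where
  "is_BLUP J N K n P X T Z \<longleftrightarrow>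
     linear_predictor J N K n X Z \<and> unbiased_predictor P T Z \<and>
     (\<forall>Z'. linear_predictor J N K n X Z' \<longrightarrow> unbiased_predictor P T Z' \<longrightarrow>
        (\<forall>\<mu> a. integral\<^sup>L (P \<mu> a) (\<lambda>x. (Z x - T x)\<^sup>2) \<le> integral\<^sup>L (P \<mu> a) (\<lambda>x. (Z' x - T x)\<^sup>2)))"

text \<open>The vector \<open>\<Psi>\<close> is indexed by the pairs \<open>(i, j)\<close>, its entry being \<open>\<alpha>\<^sub>j\<^sub>i\<close>.\<close>

definition Psi_index :: "nat \<Rightarrow> nat \<Rightarrow> (nat \<times> nat) set" where
  "Psi_index J N = {1..N} \<times> {1..J-1}"

definition Psi :: "(latent \<Rightarrow> 'a \<Rightarrow> real) \<Rightarrow> nat \<times> nat \<Rightarrow> 'a \<Rightarrow> real" where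
  "Psi X = (\<lambda>(i, j). X (Alpha j i))"

definition is_Psi_BLUP ::
  "nat \<Rightarrow> nat \<Rightarrow> nat \<Rightarrow> nat \<Rightarrow> (real \<Rightarrow> (nat \<Rightarrow> real) \<Rightarrow> 'a measure) \<Rightarrow> (latent \<Rightarrow> 'a \<Rightarrow> real) \<Rightarrow>
     (nat \<times> nat \<Rightarrow> 'a \<Rightarrow> real) \<Rightarrow> bool" where
  "is_Psi_BLUP J N K n P X H \<longleftrightarrow>
     (\<forall>q\<in>Psi_index J N. is_BLUP J N K n P X (Psi X q) (H q))"

definition covariance_matrix ::
  "'a measure \<Rightarrow> ('b \<Rightarrow> 'a \<Rightarrow> real) \<Rightarrow> 'b \<Rightarrow> 'b \<Rightarrow> real" where
  "covariance_matrix M Z = (\<lambda>p q. covariance M (Z p) (Z q))"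

definition matrix_trace :: "'b set \<Rightarrow> ('b \<Rightarrow> 'b \<Rightarrow> real) \<Rightarrow> real" where
  "matrix_trace I A = (\<Sum>q\<in>I. A q q)"

definition error_trace ::
  "nat \<Rightarrow> nat \<Rightarrow> 'a measure \<Rightarrow> (latent \<Rightarrow> 'a \<Rightarrow> real) \<Rightarrow> (nat \<times> nat \<Rightarrow> 'a \<Rightarrow> real) \<Rightarrow> real" where
  "error_trace J N M X H =
     matrix_trace (Psi_index J N) (covariance_matrix M (\<lambda>q x. H q x - Psi X q x))"

text \<open>The criterion of an exact design is the trace of the error covariance matrix. A constant
  cannot quantify over all probability spaces, so the models are taken on the sample space of
  realisations \<^typ>\<open>latent \<Rightarrow> real\<close>, which carries every joint law of the latent
  variables.\<close>

definition A_exact :: "nat \<Rightarrow> nat \<Rightarrow> nat \<Rightarrow> nat \<Rightarrow> real \<Rightarrow> real \<Rightarrow> real \<Rightarrow> real" where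
  "A_exact J N K n s2 u v = (THE t.
     \<exists>(P :: real \<Rightarrow> (nat \<Rightarrow> real) \<Rightarrow> (latent \<Rightarrow> real) measure) X H \<mu> a.
       multiple_group_rcr J N K n s2 u v P X \<and> is_Psi_BLUP J N K n P X H \<and>
       t = error_trace J N (P \<mu> a) X H)"

text \<open>For an approximate design, real numbers are substituted for \<open>n\<close> and \<open>m\<close> in the exact
  criterion. This is meaningful because the exact criterion is a rational expression in \<open>n\<close> and
  \<open>m\<close>: at most one rational function without poles in the open positive quadrant takes given
  values at all pairs of positive integers.\<close>

definition poly2 :: "real poly poly \<Rightarrow> real \<Rightarrow> real \<Rightarrow> real" where
  "poly2 p x y = poly (poly p [:y:]) x"

definition rational_function2 :: "(real \<Rightarrow> real \<Rightarrow> real) \<Rightarrow> bool" where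
  "rational_function2 F \<longleftrightarrow> (\<exists>p q. \<forall>x>0. \<forall>y>0. poly2 q x y \<noteq> 0 \<and> F x y = poly2 p x y / poly2 q x y)"

definition extends_A_exact ::
  "nat \<Rightarrow> nat \<Rightarrow> real \<Rightarrow> real \<Rightarrow> real \<Rightarrow> (real \<Rightarrow> real \<Rightarrow> real) \<Rightarrow> bool" where
  "extends_A_exact J K s2 u v F \<longleftrightarrow> rational_function2 F \<and>
     (\<forall>n m :: nat. n \<ge> 1 \<longrightarrow> m \<ge> 1 \<longrightarrow> F (real n) (real m) = A_exact J ((J - 1) * n + m) K n s2 u v)"

definition A_Psi :: "nat \<Rightarrow> nat \<Rightarrow> nat \<Rightarrow> real \<Rightarrow> real \<Rightarrow> real \<Rightarrow> real \<Rightarrow> real" where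
  "A_Psi J N K s2 u v w = (THE t.
     \<exists>F. extends_A_exact J K s2 u v F \<and> t = F (real N * w) (real N * (1 - (real J - 1) * w)))"

end

theory Submission
  imports Defs
begin

text \<open>
  Two facts have to be combined: the error variances of the best linear unbiased predictors in an
  exact design, and the uniqueness of their rational extension in \<open>n\<close> and \<open>m\<close>.

  A linear unbiased predictor \<open>Z\<close> of \<open>T\<close> is best if its error \<open>Z - T\<close> is uncorrelated with every
  linear combination of observations that has expectation \<open>0\<close> for all parameters. Since the
  expectation of an observation is an arbitrary function of its group, it suffices that the
  covariance of \<open>Z - T\<close> with an observation depends only on the group
  (\<open>is_BLUP_if_covariance_group_function\<close>). For \<open>T = \<alpha>\<^sub>j\<^sub>i\<close> this is achieved by the difference of
  the mean observations in group \<open>j\<close> and the control group, to which, if \<open>i\<close> belongs to group \<open>j\<close>,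
  the deviation of the mean of individual \<open>i\<close> from the group mean is added with the factor
  \<open>v / a\<close>; here \<open>a = u + v + 1 / K\<close> and \<open>b = u + 1 / K\<close> are the variances of individual means in
  units of \<open>\<sigma>\<^sup>2\<close>. In these units the error variance is \<open>a / n + b / m + v\<close>, reduced by
  \<open>2 v / n + (v\<^sup>2 / a) (1 - 1 / n)\<close> for the \<open>n\<close> individuals of group \<open>j\<close>. The sum over all \<open>j < J\<close>
  and all \<open>i\<close> is
  \<open>(J - 1) (N (a / n + b / m + v) - 2 v - (v\<^sup>2 / a) (n - 1))\<close>.
  All best predictors have the same error variance, so the sum does not depend on their choice,
  nor on the probability measure or the parameters.

  For the criterion \<open>A_exact\<close> to have this value, some model must exist
  (\<open>multiple_group_rcr_one_deviation_pmf\<close>). With \<open>N = (J - 1) n + m\<close>, the value is a rational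
  function of \<open>n\<close> and \<open>m\<close>, and two rational functions agreeing at all pairs of positive integers
  agree on the positive quadrant (\<open>rational_function2_eqI\<close>), because a polynomial vanishing on that
  grid is zero. It remains to put \<open>n = N w\<close> and \<open>m = N (1 - (J - 1) w)\<close>, for which
  \<open>(J - 1) n + m = N\<close>.
\<close>

section \<open>Covariances of square integrable random variables\<close>

definition finite_second_moment :: "'a measure \<Rightarrow> ('a \<Rightarrow> real) \<Rightarrow> bool" where
  "finite_second_moment M Z \<longleftrightarrow> Z \<in> borel_measurable M \<and> integrable M (\<lambda>x. (Z x)\<^sup>2)"

lemma integrable_product:
  assumes "finite_second_moment M Z" "finite_second_moment M W"
  shows "integrable M (\<lambda>x. Z x * W x)"
proof (rule Bochner_Integration.integrable_bound)
  show "integrable M (\<lambda>x. (Z x)\<^sup>2 + (W x)\<^sup>2)"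
    using assms by (simp add: finite_second_moment_def)
  show "(\<lambda>x. Z x * W x) \<in> borel_measurable M"
    using assms by (auto simp: finite_second_moment_def intro: borel_measurable_times)
  have "\<bar>z * w\<bar> \<le> z\<^sup>2 + w\<^sup>2" for z w :: real
  proof -
    have "2 * (\<bar>z\<bar> * \<bar>w\<bar>) \<le> z\<^sup>2 + w\<^sup>2"
      using zero_le_power2[of "\<bar>z\<bar> - \<bar>w\<bar>"] by (simp add: power2_diff)
    moreover have "0 \<le> \<bar>z\<bar> * \<bar>w\<bar>"
      by simp
    ultimately show ?thesis
      unfolding abs_mult by linarith
  qed
  then show "AE x in M. norm (Z x * W x) \<le> norm ((Z x)\<^sup>2 + (W x)\<^sup>2)"
    by simp
qed

lemma finite_second_moment_add:
  assumes "finite_second_moment M Z" "finite_second_moment M W"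
  shows "finite_second_moment M (\<lambda>x. Z x + W x)"
  using assms integrable_product[OF assms]
  by (auto simp: finite_second_moment_def power2_sum mult.assoc intro: borel_measurable_add)

lemma finite_second_moment_cmult:
  "finite_second_moment M Z \<Longrightarrow> finite_second_moment M (\<lambda>x. c * Z x)"
  by (auto simp: finite_second_moment_def power_mult_distrib intro: borel_measurable_times)

lemma finite_second_moment_diff:
  assumes "finite_second_moment M Z" "finite_second_moment M W"
  shows "finite_second_moment M (\<lambda>x. Z x - W x)"
  using finite_second_moment_add[OF assms(1) finite_second_moment_cmult[OF assms(2), of "-1"]]
  by simp

lemma finite_second_moment_sum:
  assumes "\<And>i. i \<in> I \<Longrightarrow> finite_second_moment M (Z i)"
  shows "finite_second_moment M (\<lambda>x. \<Sum>i\<in>I. Z i x)"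
  using assms
  by (induction I rule: infinite_finite_induct)
     (auto intro: finite_second_moment_add simp: finite_second_moment_def[of _ "\<lambda>x. 0"])

lemma covariance_commute: "covariance M Z W = covariance M W Z"
  by (simp add: covariance_def mult.commute)

context prob_space
begin

lemma integrable_if_finite_second_moment:
  assumes "finite_second_moment M Z"
  shows "integrable M Z"
  using integrable_product[OF assms, of "\<lambda>x. 1"] by (simp add: finite_second_moment_def)

lemma covariance_eq:
  assumes "finite_second_moment M Z" "finite_second_moment M W"
  shows "covariance M Z W = expectation (\<lambda>x. Z x * W x) - expectation Z * expectation W"
proof -
  note [simp] = integrable_product[OF assms] assms[THEN integrable_if_finite_second_moment]
  have "covariance M Z W = expectation (\<lambda>x. Z x * W x - expectation W * Z x
      - expectation Z * W x + expectation Z * expectation W)"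
    by (simp add: covariance_def algebra_simps)
  also have "\<dots> = expectation (\<lambda>x. Z x * W x) - expectation Z * expectation W"
    by (simp add: prob_space)
  finally show ?thesis .
qed

lemma covariance_add_left:
  assumes "finite_second_moment M Z" "finite_second_moment M Z'" "finite_second_moment M W"
  shows "covariance M (\<lambda>x. Z x + Z' x) W = covariance M Z W + covariance M Z' W"
  using assms by (simp add: covariance_eq finite_second_moment_add distrib_right
      integrable_product integrable_if_finite_second_moment)

lemma covariance_cmult_left:
  assumes "finite_second_moment M Z" "finite_second_moment M W"
  shows "covariance M (\<lambda>x. c * Z x) W = c * covariance M Z W"
  using assms by (simp add: covariance_eq finite_second_moment_cmult mult.assoc right_diff_distrib)

lemma covariance_diff_left:
  assumes "finite_second_moment M Z" "finite_second_moment M Z'" "finite_second_moment M W"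
  shows "covariance M (\<lambda>x. Z x - Z' x) W = covariance M Z W - covariance M Z' W"
  using covariance_add_left[OF assms(1) finite_second_moment_cmult[OF assms(2), of "-1"] assms(3)]
    covariance_cmult_left[OF assms(2,3), of "-1"]
  by simp

lemma covariance_sum_left:
  assumes "\<And>i. i \<in> I \<Longrightarrow> finite_second_moment M (Z i)" "finite_second_moment M W"
  shows "covariance M (\<lambda>x. \<Sum>i\<in>I. Z i x) W = (\<Sum>i\<in>I. covariance M (Z i) W)"
  using assms
proof (induction I rule: infinite_finite_induct)
  case (insert i I)
  then show ?case
    by (simp add: covariance_add_left finite_second_moment_sum)
qed (simp_all add: covariance_def)

lemma covariance_linear_combination_left:
  assumes "\<And>i. i \<in> I \<Longrightarrow> finite_second_moment M (Z i)" "finite_second_moment M W"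
  shows "covariance M (\<lambda>x. \<Sum>i\<in>I. c i * Z i x) W = (\<Sum>i\<in>I. c i * covariance M (Z i) W)"
  using assms by (simp add: covariance_sum_left covariance_cmult_left finite_second_moment_cmult)

text \<open>Orthogonality makes the second moment additive; this is how the optimality of a predictor
  will be proved.\<close>

lemma second_moment_le_of_uncorrelated:
  assumes "finite_second_moment M Z" "finite_second_moment M W"
    and "covariance M Z W = 0" "expectation W = 0"
  shows "expectation (\<lambda>x. (Z x)\<^sup>2) \<le> expectation (\<lambda>x. (Z x + W x)\<^sup>2)"
proof -
  have "expectation (\<lambda>x. Z x * W x) = 0"
    using assms by (simp add: covariance_eq)
  moreover have "expectation (\<lambda>x. (Z x + W x)\<^sup>2) =
      expectation (\<lambda>x. (Z x)\<^sup>2 + (W x)\<^sup>2 + 2 * (Z x * W x))"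
    by (simp add: power2_sum mult.assoc)
  ultimately show ?thesis
    using assms integrable_product[OF assms(1,2)]
    by (simp add: finite_second_moment_def)
qed

end


section \<open>The groups of individuals\<close>

lemma group_unique:
  assumes "i \<in> group J N n j" "i \<in> group J N n j'" "j \<in> {1..J}" "j' \<in> {1..J}"
  shows "j = j'"
proof -
  have no: False if "i \<in> group J N n j" "i \<in> group J N n j'" "j < j'" "j' \<le> J" for j j'
  proof -
    have "i \<le> j * n" "(j' - 1) * n < i"
      using that by (auto simp: group_def group_end_def split: if_splits)
    moreover have "j * n \<le> (j' - 1) * n"
      using that by (intro mult_right_mono) auto
    ultimately show False
      by simp
  qed
  show ?thesis
    using no[of j j'] no[of j' j] assms by (cases j j' rule: linorder_cases) auto
qed

lemma finite_group: "finite (group J N n j)"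
  by (simp add: group_def)

lemma card_treatment_group:
  assumes "j \<in> {1..J-1}"
  shows "card (group J N n j) = n"
proof -
  have "j * n - (j - 1) * n = n"
    using assms by (cases j) auto
  then show ?thesis
    using assms by (auto simp: group_def group_end_def)
qed

lemma card_control_group: "J \<ge> 1 \<Longrightarrow> card (group J N n J) = N - (J - 1) * n"
  by (auto simp: group_def group_end_def)

lemma group_subset:
  assumes "(J - 1) * n < N" "j \<in> {1..J}"
  shows "group J N n j \<subseteq> {1..N}"
proof -
  have "j * n \<le> N" if "j \<noteq> J"
  proof -
    have "j * n \<le> (J - 1) * n"
      using assms that by (intro mult_right_mono) auto
    then show ?thesis
      using assms by linarith
  qed
  then show ?thesis
    by (auto simp: group_def group_end_def intro: order_trans)
qed

lemma obs_eq_Sigma: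
  "obs J N K n = Sigma {1..J} (\<lambda>j. group J N n j \<times> {1..K})"
  by (auto simp: obs_def)

lemma finite_obs: "finite (obs J N K n)"
  by (auto simp: obs_eq_Sigma finite_group)

lemma sum_obs:
  "(\<Sum>q\<in>obs J N K n. f q) = (\<Sum>j\<in>{1..J}. \<Sum>i\<in>group J N n j. \<Sum>k\<in>{1..K}. f (j, i, k))"
  by (simp add: obs_eq_Sigma sum.Sigma sum.cartesian_product finite_group)

lemma finite_latents: "finite (latents J N K n)"
proof -
  have "{Alpha j i | j i. j \<in> {1..J-1} \<and> i \<in> {1..N}} = (\<lambda>(j, i). Alpha j i) ` ({1..J-1} \<times> {1..N})"
    "{Eps j i k | j i k. (j, i, k) \<in> obs J N K n} = (\<lambda>(j, i, k). Eps j i k) ` obs J N K n"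
    by force+
  then show ?thesis
    by (simp add: latents_def finite_obs)
qed


section \<open>Moments of the observations\<close>

text \<open>An observation is the sum of the latent variables in this set, so that the covariance of two
  observations is the total variance of the latent variables which they share.\<close>

fun components :: "nat \<Rightarrow> nat \<times> nat \<times> nat \<Rightarrow> latent set" where
  "components J (j, i, k) = {Mu i, Eps j i k} \<union> (if j < J then {Alpha j i} else {})"

fun latent_variance :: "real \<Rightarrow> real \<Rightarrow> latent \<Rightarrow> real" where
  "latent_variance u v (Mu i) = u"
| "latent_variance u v (Alpha j i) = v"
| "latent_variance u v (Eps j i k) = 1"

lemma Y_eq_sum_components: "Y J X q = (\<lambda>x. \<Sum>r\<in>components J q. X r x)"
  by (cases q) (auto simp: Y_def fun_eq_iff)

text \<open>The variance, in units of \<open>\<sigma>\<^sup>2\<close>, of the mean of the \<open>K\<close> observations of an individual of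
  group \<open>j\<close>.\<close>

definition individual_variance :: "nat \<Rightarrow> nat \<Rightarrow> real \<Rightarrow> real \<Rightarrow> nat \<Rightarrow> real" where
  "individual_variance J K u v j = u + (if j < J then v else 0) + 1 / real K"

context multiple_group_rcr
begin

lemma components_subset:
  assumes "q \<in> obs J N K n"
  shows "components J q \<subseteq> latents J N K n"
proof -
  obtain j i k where q: "q = (j, i, k)"
    by (cases q)
  then have "i \<in> {1..N}"
    using assms group_subset[OF control_nonempty, of j] by (auto simp: obs_def)
  then show ?thesis
    using assms by (auto simp: q latents_def obs_def)
qed

lemma finite_second_moment_latent:
  "r \<in> latents J N K n \<Longrightarrow> finite_second_moment (P \<mu> a) (X r)"
  by (simp add: finite_second_moment_def measurable square_integrable)

lemma finite_second_moment_Y: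
  "q \<in> obs J N K n \<Longrightarrow> finite_second_moment (P \<mu> a) (Y J X q)"
  unfolding Y_eq_sum_components
  using components_subset by (blast intro: finite_second_moment_sum finite_second_moment_latent)

lemma finite_second_moment_linear_predictor:
  "finite_second_moment (P \<mu> a) (\<lambda>x. \<Sum>q\<in>obs J N K n. c q * Y J X q x)"
  by (intro finite_second_moment_sum finite_second_moment_cmult finite_second_moment_Y)

lemma covariance_latent:
  assumes "r \<in> latents J N K n" "s \<in> latents J N K n"
  shows "covariance (P \<mu> a) (X r) (X s) = (if r = s then s2 * latent_variance u v r else 0)"
  using assms uncorrelated var_Mu var_Alpha var_Eps by (cases r) (auto simp: mult.commute)

lemma covariance_latent_sums:
  assumes "A \<subseteq> latents J N K n" "B \<subseteq> latents J N K n"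
  shows "covariance (P \<mu> a) (\<lambda>x. \<Sum>r\<in>A. X r x) (\<lambda>x. \<Sum>s\<in>B. X s x)
    = s2 * (\<Sum>r\<in>A \<inter> B. latent_variance u v r)"
proof -
  interpret prob_space "P \<mu> a"
    by (rule prob)
  have fin: "finite A" "finite B"
    using assms finite_latents finite_subset by blast+
  have fsm: "finite_second_moment (P \<mu> a) (X r)" if "r \<in> A \<union> B" for r
    using that assms finite_second_moment_latent by blast
  have "covariance (P \<mu> a) (\<lambda>x. \<Sum>r\<in>A. X r x) (\<lambda>x. \<Sum>s\<in>B. X s x)
      = (\<Sum>r\<in>A. \<Sum>s\<in>B. covariance (P \<mu> a) (X s) (X r))"
    using fsm by (simp add: covariance_sum_left finite_second_moment_sum
        covariance_commute[of _ "X _" "\<lambda>x. \<Sum>s\<in>B. X s x"])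
  also have "\<dots> = (\<Sum>r\<in>A. \<Sum>s\<in>B. if s = r then s2 * latent_variance u v s else 0)"
    using assms by (intro sum.cong refl covariance_latent) auto
  also have "\<dots> = (\<Sum>r\<in>A. if r \<in> B then s2 * latent_variance u v r else 0)"
    using fin by (simp add: sum.delta)
  also have "\<dots> = s2 * (\<Sum>r\<in>A \<inter> B. latent_variance u v r)"
    using fin by (simp add: sum.inter_restrict sum_distrib_left if_distrib cong: if_cong)
  finally show ?thesis .
qed

lemma covariance_Y_Y:
  assumes "(j, i, k) \<in> obs J N K n" "(j', i', k') \<in> obs J N K n"
  shows "covariance (P \<mu> a) (Y J X (j, i, k)) (Y J X (j', i', k')) =
    (if j = j' \<and> i = i' then s2 * (u + (if j < J then v else 0) + (if k = k' then 1 else 0)) else 0)"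
proof -
  have "j = j'" if "i = i'"
    using that assms group_unique[of i J N n j j'] by (auto simp: obs_def)
  then show ?thesis
    unfolding Y_eq_sum_components covariance_latent_sums[OF assms[THEN components_subset]]
    by (auto simp: Int_insert_left)
qed

lemma covariance_Y_Alpha:
  assumes "(j, i, k) \<in> obs J N K n" "j0 \<in> {1..J-1}" "i0 \<in> {1..N}"
  shows "covariance (P \<mu> a) (Y J X (j, i, k)) (X (Alpha j0 i0)) =
    (if j = j0 \<and> i = i0 then s2 * v else 0)"
proof -
  have "{Alpha j0 i0} \<subseteq> latents J N K n"
    using assms by (auto simp: latents_def)
  then show ?thesis
    using covariance_latent_sums[OF components_subset[OF assms(1)], of "{Alpha j0 i0}" \<mu> a] assms
    by (auto simp: Y_eq_sum_components)
qed

lemma expectation_Y: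
  assumes "(j, i, k) \<in> obs J N K n"
  shows "integral\<^sup>L (P \<mu> a) (Y J X (j, i, k)) = \<mu> + (if j < J then a j else 0)"
proof -
  interpret prob_space "P \<mu> a"
    by (rule prob)
  have sub: "components J (j, i, k) \<subseteq> latents J N K n"
    using components_subset[OF assms] .
  have "integral\<^sup>L (P \<mu> a) (Y J X (j, i, k)) = (\<Sum>r\<in>components J (j, i, k). integral\<^sup>L (P \<mu> a) (X r))"
    unfolding Y_eq_sum_components using sub
    by (intro Bochner_Integration.integral_sum integrable_if_finite_second_moment
        finite_second_moment_latent) auto
  then show ?thesis
    using sub by (auto simp: mean_Mu mean_Alpha mean_Eps)
qed

lemma expectation_linear_predictor:
  "integral\<^sup>L (P \<mu> a) (\<lambda>x. \<Sum>q\<in>obs J N K n. c q * Y J X q x)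
    = (\<Sum>q\<in>obs J N K n. c q * (\<mu> + (if fst q < J then a (fst q) else 0)))"
proof -
  interpret prob_space "P \<mu> a"
    by (rule prob)
  have "integral\<^sup>L (P \<mu> a) (\<lambda>x. \<Sum>q\<in>obs J N K n. c q * Y J X q x)
      = (\<Sum>q\<in>obs J N K n. c q * integral\<^sup>L (P \<mu> a) (Y J X q))"
    by (simp add: Bochner_Integration.integral_sum integrable_if_finite_second_moment
        finite_second_moment_Y)
  also have "\<dots> = (\<Sum>q\<in>obs J N K n. c q * (\<mu> + (if fst q < J then a (fst q) else 0)))"
    by (intro sum.cong) (auto simp: expectation_Y)
  finally show ?thesis .
qed

end


section \<open>A sufficient condition for a best linear unbiased predictor\<close>

context multiple_group_rcr
begin

text \<open>A function \<open>\<kappa>\<close> of the group is itself a vector of expectations of the observations, namely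
  for the parameters \<open>\<mu> = \<kappa> J\<close> and \<open>\<alpha>\<^sub>j = \<kappa> j - \<kappa> J\<close>. Weighted sums of \<open>\<kappa>\<close> over the observations
  are therefore expectations of linear predictors, to which unbiasedness applies.\<close>

lemma sum_group_function_eq_expectation:
  "(\<Sum>q\<in>obs J N K n. c q * \<kappa> (fst q)) = integral\<^sup>L (P (\<kappa> J) (\<lambda>j. \<kappa> j - \<kappa> J))
     (\<lambda>x. \<Sum>q\<in>obs J N K n. c q * Y J X q x)"
  unfolding expectation_linear_predictor
  by (intro sum.cong refl) (auto simp: obs_def)

text \<open>The difference of two unbiased linear predictors has expectation \<open>0\<close> for all parameters. By
  the preceding lemma it is then uncorrelated with any variable whose covariance with an observation
  depends only on the group.\<close>

lemma is_BLUP_if_covariance_group_function: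
  assumes T: "\<And>\<mu> a. finite_second_moment (P \<mu> a) T"
    and Z: "Z = (\<lambda>x. \<Sum>q\<in>obs J N K n. c q * Y J X q x)"
    and unbiased: "unbiased_predictor P T Z"
    and cov: "\<And>\<mu> a q. q \<in> obs J N K n \<Longrightarrow>
      covariance (P \<mu> a) (Y J X q) (\<lambda>x. Z x - T x) = \<kappa> (fst q)"
  shows "is_BLUP J N K n P X T Z"
  unfolding is_BLUP_def
proof (intro conjI allI impI)
  show "linear_predictor J N K n X Z"
    using Z by (auto simp: linear_predictor_def)
  show "unbiased_predictor P T Z"
    by (rule unbiased)
  fix Z' \<mu> a
  assume "linear_predictor J N K n X Z'" and unbiased': "unbiased_predictor P T Z'"
  then obtain c' where Z': "Z' = (\<lambda>x. \<Sum>q\<in>obs J N K n. c' q * Y J X q x)"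
    by (auto simp: linear_predictor_def)
  define d where "d = (\<lambda>q. c' q - c q)"
  define D where "D = (\<lambda>x. \<Sum>q\<in>obs J N K n. d q * Y J X q x)"
  have D_eq: "D = (\<lambda>x. Z' x - Z x)"
    by (simp add: D_def d_def Z Z' left_diff_distrib sum_subtractf)
  have fsm: "finite_second_moment (P \<mu> a) Z" "finite_second_moment (P \<mu> a) Z'"
    "finite_second_moment (P \<mu> a) D" for \<mu> a
    unfolding Z Z' D_def by (rule finite_second_moment_linear_predictor)+
  have mean_D: "integral\<^sup>L (P \<mu> a) D = 0" for \<mu> a
  proof -
    interpret prob_space "P \<mu> a"
      by (rule prob)
    show ?thesis
      using unbiased unbiased' fsm
      by (simp add: D_eq unbiased_predictor_def integrable_if_finite_second_moment)
  qed
  interpret prob_space "P \<mu> a"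
    by (rule prob)
  have error: "finite_second_moment (P \<mu> a) (\<lambda>x. Z x - T x)"
    using fsm T by (intro finite_second_moment_diff)
  have "covariance (P \<mu> a) D (\<lambda>x. Z x - T x) = (\<Sum>q\<in>obs J N K n. d q * \<kappa> (fst q))"
    unfolding D_def using error
    by (simp add: covariance_linear_combination_left finite_second_moment_Y cov)
  also have "\<dots> = 0"
    unfolding sum_group_function_eq_expectation using mean_D by (simp add: D_def)
  finally have "covariance (P \<mu> a) (\<lambda>x. Z x - T x) D = 0"
    by (simp add: covariance_commute)
  then have "expectation (\<lambda>x. (Z x - T x)\<^sup>2) \<le> expectation (\<lambda>x. (Z x - T x + D x)\<^sup>2)"
    using second_moment_le_of_uncorrelated[OF error fsm(3)] mean_D by blast
  then show "expectation (\<lambda>x. (Z x - T x)\<^sup>2) \<le> expectation (\<lambda>x. (Z' x - T x)\<^sup>2)"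
    by (simp add: D_eq)
qed

text \<open>Splitting the error variance as \<open>Cov(Z, Z - T) - Cov(T, Z - T)\<close>, the first term is an
  expectation of \<open>Z\<close>, and hence of \<open>T\<close>, for suitable parameters.\<close>

lemma error_variance_if_covariance_group_function:
  assumes T: "finite_second_moment (P \<mu> a) T"
    and Z: "Z = (\<lambda>x. \<Sum>q\<in>obs J N K n. c q * Y J X q x)"
    and unbiased: "unbiased_predictor P T Z"
    and cov: "\<And>q. q \<in> obs J N K n \<Longrightarrow>
      covariance (P \<mu> a) (Y J X q) (\<lambda>x. Z x - T x) = \<kappa> (fst q)"
  shows "covariance (P \<mu> a) (\<lambda>x. Z x - T x) (\<lambda>x. Z x - T x) =
    integral\<^sup>L (P (\<kappa> J) (\<lambda>j. \<kappa> j - \<kappa> J)) T + covariance (P \<mu> a) T T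
    - (\<Sum>q\<in>obs J N K n. c q * covariance (P \<mu> a) (Y J X q) T)"
proof -
  interpret prob_space "P \<mu> a"
    by (rule prob)
  have fsm_Z: "finite_second_moment (P \<mu> a) Z"
    unfolding Z by (rule finite_second_moment_linear_predictor)
  note error = finite_second_moment_diff[OF fsm_Z T]
  have "covariance (P \<mu> a) Z (\<lambda>x. Z x - T x) = (\<Sum>q\<in>obs J N K n. c q * \<kappa> (fst q))"
    using covariance_linear_combination_left[OF finite_second_moment_Y error, of "obs J N K n" "\<lambda>q. q" c]
    by (simp add: cov flip: Z)
  also have "\<dots> = integral\<^sup>L (P (\<kappa> J) (\<lambda>j. \<kappa> j - \<kappa> J)) T"
    using unbiased by (simp add: sum_group_function_eq_expectation unbiased_predictor_def flip: Z)
  finally have ZE: "covariance (P \<mu> a) Z (\<lambda>x. Z x - T x) = integral\<^sup>L (P (\<kappa> J) (\<lambda>j. \<kappa> j - \<kappa> J)) T" .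
  have ZT: "covariance (P \<mu> a) Z T = (\<Sum>q\<in>obs J N K n. c q * covariance (P \<mu> a) (Y J X q) T)"
    unfolding Z using T by (simp add: covariance_linear_combination_left finite_second_moment_Y)
  have "covariance (P \<mu> a) T (\<lambda>x. Z x - T x) = covariance (P \<mu> a) Z T - covariance (P \<mu> a) T T"
    using covariance_diff_left[OF fsm_Z T T] by (simp add: covariance_commute)
  then show ?thesis
    using covariance_diff_left[OF fsm_Z T error] ZE ZT by simp
qed

text \<open>Errors of unbiased predictors have mean \<open>0\<close>, so their variances are the mean squared errors, and
  each of two best predictors is at least as good as the other.\<close>

lemma is_BLUP_error_variance_unique:
  assumes T: "\<And>\<mu> a. finite_second_moment (P \<mu> a) T"
    and "is_BLUP J N K n P X T Z" "is_BLUP J N K n P X T Z'"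
  shows "covariance (P \<mu> a) (\<lambda>x. Z x - T x) (\<lambda>x. Z x - T x) =
    covariance (P \<mu> a) (\<lambda>x. Z' x - T x) (\<lambda>x. Z' x - T x)"
proof -
  interpret prob_space "P \<mu> a"
    by (rule prob)
  have "covariance (P \<mu> a) (\<lambda>x. Z x - T x) (\<lambda>x. Z x - T x) = expectation (\<lambda>x. (Z x - T x)\<^sup>2)"
    if "is_BLUP J N K n P X T Z" for Z
  proof -
    have fsm_Z: "finite_second_moment (P \<mu> a) Z"
      using that finite_second_moment_linear_predictor by (auto simp: is_BLUP_def linear_predictor_def)
    then have "expectation (\<lambda>x. Z x - T x) = 0"
      using that T by (simp add: integrable_if_finite_second_moment is_BLUP_def unbiased_predictor_def)
    then show ?thesis
      by (simp add: covariance_def power2_eq_square)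
  qed
  moreover have "expectation (\<lambda>x. (Z x - T x)\<^sup>2) = expectation (\<lambda>x. (Z' x - T x)\<^sup>2)"
    using assms(2,3) by (intro antisym) (auto simp: is_BLUP_def)
  ultimately show ?thesis
    using assms(2,3) by simp
qed

end


section \<open>The best linear unbiased predictor of an individual treatment effect\<close>

text \<open>The weights, up to the factor \<open>1 / K\<close>, of the observations in the predictor of
  \<open>\<alpha>\<^bsub>j0 i0\<^esub>\<close>. They estimate \<open>\<alpha>\<^bsub>j0\<^esub>\<close> by the difference of the mean observations in group \<open>j0\<close> and
  in the control group. An individual \<open>i0\<close> of group \<open>j0\<close> gives information on its own treatment
  effect beyond this: the deviation of its mean from the group mean is added, shrunk by the ratio of
  \<open>v\<close> to the variance of the individual mean.\<close>

definition predictor_weight ::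
  "nat \<Rightarrow> nat \<Rightarrow> nat \<Rightarrow> nat \<Rightarrow> real \<Rightarrow> real \<Rightarrow> nat \<Rightarrow> nat \<Rightarrow> nat \<Rightarrow> nat \<Rightarrow> real" where
  "predictor_weight J N K n u v j0 i0 j i =
     (if j = j0 then 1 / real n + (if i0 \<in> group J N n j0
        then v / individual_variance J K u v j0 * ((if i = i0 then 1 else 0) - 1 / real n) else 0)
      else 0) - (if j = J then 1 / real (N - (J - 1) * n) else 0)"

definition effect_predictor ::
  "nat \<Rightarrow> nat \<Rightarrow> nat \<Rightarrow> nat \<Rightarrow> real \<Rightarrow> real \<Rightarrow> (latent \<Rightarrow> 'a \<Rightarrow> real) \<Rightarrow> nat \<Rightarrow> nat \<Rightarrow> 'a \<Rightarrow> real" where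
  "effect_predictor J N K n u v X j0 i0 = (\<lambda>x. \<Sum>q\<in>obs J N K n.
     (predictor_weight J N K n u v j0 i0 (fst q) (fst (snd q)) / real K) * Y J X q x)"

lemma sum_predictor_weight:
  assumes "J \<ge> 2" "n \<ge> 1" "(J - 1) * n < N" "j0 \<in> {1..J-1}" "j \<in> {1..J}"
  shows "(\<Sum>i\<in>group J N n j. predictor_weight J N K n u v j0 i0 j i) =
    (if j = j0 then 1 else 0) - (if j = J then 1 else 0)"
proof -
  define m where "m = N - (J - 1) * n"
  have card_J: "card (group J N n J) = m"
    using assms by (simp add: m_def card_control_group)
  have m: "m \<noteq> 0"
    using assms(3) by (simp add: m_def)
  have card_j0: "card (group J N n j0) = n"
    using assms card_treatment_group by blast
  consider "j = j0" "j \<noteq> J" | "j = J" "j \<noteq> j0" | "j \<noteq> j0" "j \<noteq> J"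
    using assms by fastforce
  then show ?thesis
  proof cases
    case 1
    have "(\<Sum>i\<in>group J N n j0. (if i = i0 then 1 else 0) - 1 / real n) = 0"
      if "i0 \<in> group J N n j0"
      using that assms by (simp add: sum_subtractf card_j0 sum.delta finite_group)
    then show ?thesis
      using 1 assms by (cases "i0 \<in> group J N n j0")
        (simp_all add: predictor_weight_def sum.distrib card_j0
          del: times_divide_eq_left flip: sum_distrib_left)
  next
    case 2
    then show ?thesis
      using card_J m unfolding predictor_weight_def m_def[symmetric] by (simp add: sum_negf)
  next
    case 3
    then show ?thesis
      by (simp add: predictor_weight_def)
  qed
qed

context multiple_group_rcr
begin

lemma individual_variance_pos: "individual_variance J K u v j > 0"
  using u_pos v_pos by (simp add: individual_variance_def add_pos_nonneg)

lemma covariance_Y_weighted_means: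
  assumes obs: "(j, i, k) \<in> obs J N K n"
  shows "covariance (P \<mu> a) (Y J X (j, i, k))
      (\<lambda>x. \<Sum>q\<in>obs J N K n. (g (fst q) (fst (snd q)) / real K) * Y J X q x)
    = s2 * individual_variance J K u v j * g j i"
proof -
  interpret prob_space "P \<mu> a"
    by (rule prob)
  have j: "j \<in> {1..J}" and i: "i \<in> group J N n j" and k: "k \<in> {1..K}"
    using obs by (auto simp: obs_def)
  have "covariance (P \<mu> a) (Y J X (j, i, k))
      (\<lambda>x. \<Sum>q\<in>obs J N K n. (g (fst q) (fst (snd q)) / real K) * Y J X q x)
    = (\<Sum>q\<in>obs J N K n. (g (fst q) (fst (snd q)) / real K) *
        covariance (P \<mu> a) (Y J X q) (Y J X (j, i, k)))"
    unfolding covariance_commute[of _ "Y J X (j, i, k)"]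
    by (intro covariance_linear_combination_left finite_second_moment_Y obs)
  also have "\<dots> = (\<Sum>q\<in>obs J N K n. (g (fst q) (fst (snd q)) / real K) *
      (if fst q = j \<and> fst (snd q) = i then s2 * (u + (if j < J then v else 0)
         + (if snd (snd q) = k then 1 else 0)) else 0))"
    by (intro sum.cong refl arg_cong2[of _ _ _ _ "(*)"]) (auto simp: covariance_Y_Y obs)
  also have "\<dots> = (\<Sum>j'\<in>{1..J}. \<Sum>i'\<in>group J N n j'. if j' = j \<and> i' = i
      then \<Sum>k'\<in>{1..K}. g j i / real K * (s2 * (u + (if j < J then v else 0)
         + (if k' = k then 1 else 0))) else 0)"
    unfolding sum_obs by (intro sum.cong refl) auto
  also have "\<dots> = (\<Sum>j'\<in>{1..J}. if j' = j
      then \<Sum>k'\<in>{1..K}. g j i / real K * (s2 * (u + (if j < J then v else 0)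
         + (if k' = k then 1 else 0))) else 0)"
    using i by (intro sum.cong refl) (auto simp: sum.delta finite_group)
  also have "\<dots> = (\<Sum>k'\<in>{1..K}. g j i / real K * (s2 * (u + (if j < J then v else 0)
         + (if k' = k then 1 else 0))))"
    using j by (simp add: sum.delta)
  also have "\<dots> = g j i / real K * s2 * (real K * (u + (if j < J then v else 0)) + 1)"
    unfolding sum_distrib_left[symmetric] using k by (simp add: sum.distrib sum.delta)
  also have "\<dots> = s2 * individual_variance J K u v j * g j i"
    using K_ge_1 by (simp add: individual_variance_def field_simps)
  finally show ?thesis .
qed

lemma expectation_weighted_means:
  "integral\<^sup>L (P \<mu> a) (\<lambda>x. \<Sum>q\<in>obs J N K n. (g (fst q) (fst (snd q)) / real K) * Y J X q x)
    = (\<Sum>j\<in>{1..J}. (\<mu> + (if j < J then a j else 0)) * (\<Sum>i\<in>group J N n j. g j i))"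
  unfolding expectation_linear_predictor unfolding sum_obs using K_ge_1
  by (intro sum.cong refl) (simp add: sum_distrib_left mult.commute)

lemma Alpha_latent:
  "j0 \<in> {1..J-1} \<Longrightarrow> i0 \<in> {1..N} \<Longrightarrow> Alpha j0 i0 \<in> latents J N K n"
  by (auto simp: latents_def)

lemma unbiased_effect_predictor:
  assumes "j0 \<in> {1..J-1}" "i0 \<in> {1..N}"
  shows "unbiased_predictor P (X (Alpha j0 i0)) (effect_predictor J N K n u v X j0 i0)"
proof -
  have "(\<Sum>j\<in>{1..J}. (\<mu> + (if j < J then a j else 0)) *
      (\<Sum>i\<in>group J N n j. predictor_weight J N K n u v j0 i0 j i)) = a j0" for \<mu> a
  proof -
    have "(\<Sum>j\<in>{1..J}. (\<mu> + (if j < J then a j else 0)) *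
        (\<Sum>i\<in>group J N n j. predictor_weight J N K n u v j0 i0 j i))
      = (\<Sum>j\<in>{1..J}. (if j = j0 then \<mu> + a j0 else 0) - (if j = J then \<mu> else 0))"
      using assms J_ge_2 n_ge_1 control_nonempty
      by (intro sum.cong refl) (auto simp: sum_predictor_weight)
    also have "\<dots> = a j0"
      using assms J_ge_2 by (auto simp: sum_subtractf sum.delta)
    finally show ?thesis .
  qed
  then show ?thesis
    unfolding unbiased_predictor_def effect_predictor_def expectation_weighted_means
      mean_Alpha[OF Alpha_latent[OF assms]]
    by simp
qed

text \<open>For individuals of group \<open>j0\<close>, the shrinkage factor is exactly what makes the covariance with
  \<open>\<alpha>\<^bsub>j0 i0\<^esub>\<close> cancel for the observations of individual \<open>i0\<close>.\<close>

lemma covariance_Y_prediction_error: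
  assumes j0: "j0 \<in> {1..J-1}" and i0: "i0 \<in> {1..N}" and q: "q \<in> obs J N K n"
  shows "covariance (P \<mu> a) (Y J X q)
      (\<lambda>x. effect_predictor J N K n u v X j0 i0 x - X (Alpha j0 i0) x)
    = s2 * ((if fst q = j0 then (individual_variance J K u v j0
          - (if i0 \<in> group J N n j0 then v else 0)) / real n else 0)
        - (if fst q = J then individual_variance J K u v J / real (N - (J - 1) * n) else 0))"
proof -
  interpret prob_space "P \<mu> a"
    by (rule prob)
  obtain j i k where q_eq: "q = (j, i, k)"
    by (cases q)
  have i: "i \<in> group J N n j"
    using q by (auto simp: q_eq obs_def)
  have jJ: "j0 \<noteq> J"
    using j0 by auto
  have "covariance (P \<mu> a) (Y J X q)
      (\<lambda>x. effect_predictor J N K n u v X j0 i0 x - X (Alpha j0 i0) x)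
    = covariance (P \<mu> a) (Y J X q) (effect_predictor J N K n u v X j0 i0)
      - covariance (P \<mu> a) (Y J X q) (X (Alpha j0 i0))"
    unfolding covariance_commute[of _ "Y J X q"] effect_predictor_def
    by (intro covariance_diff_left finite_second_moment_linear_predictor
        finite_second_moment_latent Alpha_latent[OF j0 i0] finite_second_moment_Y q)
  also have "\<dots> = s2 * (individual_variance J K u v j * predictor_weight J N K n u v j0 i0 j i
      - (if j = j0 \<and> i = i0 then v else 0))"
    using q covariance_Y_weighted_means covariance_Y_Alpha[OF _ j0 i0]
    by (simp add: q_eq effect_predictor_def right_diff_distrib)
  also have "individual_variance J K u v j * predictor_weight J N K n u v j0 i0 j i
      - (if j = j0 \<and> i = i0 then v else 0) =
      (if j = j0 then (individual_variance J K u v j0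
          - (if i0 \<in> group J N n j0 then v else 0)) / real n else 0)
        - (if j = J then individual_variance J K u v J / real (N - (J - 1) * n) else 0)"
    using i jJ individual_variance_pos[of j0] n_ge_1
    by (auto simp: predictor_weight_def field_simps)
  finally show ?thesis
    by (simp add: q_eq)
qed

lemma is_BLUP_effect_predictor:
  assumes "j0 \<in> {1..J-1}" "i0 \<in> {1..N}"
  shows "is_BLUP J N K n P X (X (Alpha j0 i0)) (effect_predictor J N K n u v X j0 i0)"
  by (rule is_BLUP_if_covariance_group_function[OF _ effect_predictor_def
        unbiased_effect_predictor[OF assms] covariance_Y_prediction_error[OF assms]])
     (intro finite_second_moment_latent Alpha_latent assms)

lemma error_variance_effect_predictor:
  assumes j0: "j0 \<in> {1..J-1}" and i0: "i0 \<in> {1..N}"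
  shows "covariance (P \<mu> a)
      (\<lambda>x. effect_predictor J N K n u v X j0 i0 x - X (Alpha j0 i0) x)
      (\<lambda>x. effect_predictor J N K n u v X j0 i0 x - X (Alpha j0 i0) x)
    = s2 * (individual_variance J K u v j0 / real n
        + individual_variance J K u v J / real (N - (J - 1) * n) + v
        - (if i0 \<in> group J N n j0
           then 2 * v / real n + v\<^sup>2 / individual_variance J K u v j0 * (1 - 1 / real n) else 0))"
proof -
  let ?g = "predictor_weight J N K n u v j0 i0"
  define m where "m = real (N - (J - 1) * n)"
  have alpha: "Alpha j0 i0 \<in> latents J N K n"
    by (rule Alpha_latent[OF j0 i0])
  have jJ: "j0 \<noteq> J" "j0 \<in> {1..J}"
    using j0 by auto
  have "(\<Sum>q\<in>obs J N K n. ?g (fst q) (fst (snd q)) / real K *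
      covariance (P \<mu> a) (Y J X q) (X (Alpha j0 i0)))
    = (\<Sum>q\<in>obs J N K n. ?g (fst q) (fst (snd q)) / real K *
      (if fst q = j0 \<and> fst (snd q) = i0 then s2 * v else 0))"
    by (intro sum.cong refl arg_cong2[of _ _ _ _ "(*)"])
       (auto simp: covariance_Y_Alpha[OF _ j0 i0])
  also have "\<dots> = (\<Sum>j\<in>{1..J}. \<Sum>i\<in>group J N n j. if j = j0 \<and> i = i0 then ?g j0 i0 * (s2 * v) else 0)"
    unfolding sum_obs using K_ge_1 by (intro sum.cong refl) auto
  also have "\<dots> = (\<Sum>j\<in>{1..J}. if j = j0 then
      (if i0 \<in> group J N n j0 then ?g j0 i0 * (s2 * v) else 0) else 0)"
    by (intro sum.cong refl) (auto simp: sum.delta finite_group)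
  also have "\<dots> = (if i0 \<in> group J N n j0 then ?g j0 i0 * (s2 * v) else 0)"
    using jJ by (simp add: sum.delta)
  finally have cov_alpha: "(\<Sum>q\<in>obs J N K n. ?g (fst q) (fst (snd q)) / real K *
      covariance (P \<mu> a) (Y J X q) (X (Alpha j0 i0)))
    = (if i0 \<in> group J N n j0 then ?g j0 i0 * (s2 * v) else 0)" .
  define \<kappa> where "\<kappa> = (\<lambda>j. s2 * ((if j = j0 then (individual_variance J K u v j0
          - (if i0 \<in> group J N n j0 then v else 0)) / real n else 0)
        - (if j = J then individual_variance J K u v J / m else 0)))"
  have \<kappa>: "covariance (P \<mu> a) (Y J X q)
      (\<lambda>x. effect_predictor J N K n u v X j0 i0 x - X (Alpha j0 i0) x) = \<kappa> (fst q)"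
    if "q \<in> obs J N K n" for q
    unfolding \<kappa>_def m_def by (rule covariance_Y_prediction_error[OF j0 i0 that])
  have "covariance (P \<mu> a)
      (\<lambda>x. effect_predictor J N K n u v X j0 i0 x - X (Alpha j0 i0) x)
      (\<lambda>x. effect_predictor J N K n u v X j0 i0 x - X (Alpha j0 i0) x)
    = integral\<^sup>L (P (\<kappa> J) (\<lambda>j. \<kappa> j - \<kappa> J)) (X (Alpha j0 i0))
      + covariance (P \<mu> a) (X (Alpha j0 i0)) (X (Alpha j0 i0))
      - (\<Sum>q\<in>obs J N K n. ?g (fst q) (fst (snd q)) / real K *
          covariance (P \<mu> a) (Y J X q) (X (Alpha j0 i0)))"
    by (rule error_variance_if_covariance_group_function[OF finite_second_moment_latent[OF alpha]
        effect_predictor_def unbiased_effect_predictor[OF j0 i0] \<kappa>])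
  also have "\<dots> = (\<kappa> j0 - \<kappa> J) + v * s2 - (if i0 \<in> group J N n j0 then ?g j0 i0 * (s2 * v) else 0)"
    unfolding cov_alpha mean_Alpha[OF alpha] var_Alpha[OF alpha] by (rule refl)
  also have "\<dots> = s2 * (individual_variance J K u v j0 / real n
        + individual_variance J K u v J / m + v
        - (if i0 \<in> group J N n j0
           then 2 * v / real n + v\<^sup>2 / individual_variance J K u v j0 * (1 - 1 / real n) else 0))"
    using jJ individual_variance_pos[of j0] n_ge_1
    by (cases "i0 \<in> group J N n j0")
       (simp_all add: \<kappa>_def predictor_weight_def power2_eq_square
        algebra_simps add_divide_distrib diff_divide_distrib)
  finally show ?thesis
    unfolding m_def .
qed

end


section \<open>The trace of the error covariance matrix\<close>

text \<open>The criterion as a function of real arguments \<open>n\<close> and \<open>m\<close>, with \<open>N = (J - 1) n + m\<close>.\<close>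

definition trace_formula :: "nat \<Rightarrow> nat \<Rightarrow> real \<Rightarrow> real \<Rightarrow> real \<Rightarrow> real \<Rightarrow> real \<Rightarrow> real" where
  "trace_formula J K s2 u v n m = s2 * (real J - 1) *
     (((real J - 1) * n + m) * ((u + v + 1 / real K) / n + (u + 1 / real K) / m + v)
      - 2 * v - v\<^sup>2 / (u + v + 1 / real K) * (n - 1))"

context multiple_group_rcr
begin

lemma trace_effect_predictor:
  "error_trace J N (P \<mu> a) X (\<lambda>(i, j). effect_predictor J N K n u v X j i) =
    trace_formula J K s2 u v (real n) (real (N - (J - 1) * n))"
proof -
  let ?m = "real (N - (J - 1) * n)"
  define A where "A = (u + v + 1 / real K) / real n + (u + 1 / real K) / ?m + v"
  define B where "B = 2 * v / real n + v\<^sup>2 / (u + v + 1 / real K) * (1 - 1 / real n)"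
  have N: "real N = (real J - 1) * real n + ?m"
    using control_nonempty J_ge_2 by (simp add: of_nat_diff)
  have "error_trace J N (P \<mu> a) X (\<lambda>(i, j). effect_predictor J N K n u v X j i) =
    (\<Sum>j\<in>{1..J-1}. \<Sum>i\<in>{1..N}. s2 * (A - (if i \<in> group J N n j then B else 0)))"
    unfolding error_trace_def matrix_trace_def Psi_index_def covariance_matrix_def
      sum.cartesian_product' sum.swap[of _ "{1..N}"]
    by (intro sum.cong refl)
       (auto simp: Psi_def error_variance_effect_predictor individual_variance_def A_def B_def)
  also have "\<dots> = (\<Sum>j\<in>{1..J-1}. s2 * (real N * A - real n * B))"
  proof (intro sum.cong refl)
    fix j
    assume j: "j \<in> {1..J-1}"
    have "j \<in> {1..J}"
      using j by auto
    then have "{1..N} \<inter> group J N n j = group J N n j"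
      using group_subset[OF control_nonempty] by blast
    then have "(\<Sum>i\<in>{1..N}. if i \<in> group J N n j then B else 0) = real n * B"
      using card_treatment_group[OF j] by (simp flip: sum.inter_restrict)
    then show "(\<Sum>i\<in>{1..N}. s2 * (A - (if i \<in> group J N n j then B else 0))) =
        s2 * (real N * A - real n * B)"
      by (simp add: sum_subtractf flip: sum_distrib_left)
  qed
  also have "\<dots> = s2 * (real J - 1) * (real N * A - real n * B)"
    using J_ge_2 by (simp add: of_nat_diff)
  also have "real n * B = 2 * v + v\<^sup>2 / (u + v + 1 / real K) * (real n - 1)"
    using n_ge_1 by (simp add: B_def distrib_left right_diff_distrib)
  finally show ?thesis
    unfolding trace_formula_def A_def N by (simp add: algebra_simps)
qed

lemma is_Psi_BLUP_effect_predictor: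
  "is_Psi_BLUP J N K n P X (\<lambda>(i, j). effect_predictor J N K n u v X j i)"
  using is_BLUP_effect_predictor by (auto simp: is_Psi_BLUP_def Psi_index_def Psi_def)

lemma error_trace_eq_trace_formula:
  assumes "is_Psi_BLUP J N K n P X H"
  shows "error_trace J N (P \<mu> a) X H = trace_formula J K s2 u v (real n) (real (N - (J - 1) * n))"
proof -
  have "error_trace J N (P \<mu> a) X H =
      error_trace J N (P \<mu> a) X (\<lambda>(i, j). effect_predictor J N K n u v X j i)"
    unfolding error_trace_def matrix_trace_def covariance_matrix_def
  proof (intro sum.cong refl is_BLUP_error_variance_unique)
    fix q
    assume q: "q \<in> Psi_index J N"
    then show "is_BLUP J N K n P X (Psi X q) (H q)"
      "is_BLUP J N K n P X (Psi X q) ((\<lambda>(i, j). effect_predictor J N K n u v X j i) q)"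
      using assms is_Psi_BLUP_effect_predictor by (auto simp: is_Psi_BLUP_def)
    show "finite_second_moment (P \<mu> a) (Psi X q)" for \<mu> a
      using q Alpha_latent finite_second_moment_latent by (auto simp: Psi_index_def Psi_def)
  qed
  then show ?thesis
    by (simp add: trace_effect_predictor)
qed

end


section \<open>Existence of the model\<close>

text \<open>The criterion of an exact design is only determined by the preceding results if there is a
  model at all. Instead of independent latent variables, which would need a product measure, let a
  latent variable \<open>s\<close> and a sign be chosen uniformly at random, and let only \<open>s\<close> deviate from its
  mean, in the direction of the sign. Different latent variables are then uncorrelated because at
  most one of them deviates; the factor \<open>sqrt (card L)\<close> compensates for the probability of being
  chosen.\<close>

fun latent_mean :: "real \<Rightarrow> (nat \<Rightarrow> real) \<Rightarrow> latent \<Rightarrow> real" where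
  "latent_mean \<mu> a (Mu i) = \<mu>"
| "latent_mean \<mu> a (Alpha j i) = a j"
| "latent_mean \<mu> a (Eps j i k) = 0"

definition one_deviation ::
  "latent set \<Rightarrow> real \<Rightarrow> real \<Rightarrow> real \<Rightarrow> real \<Rightarrow> (nat \<Rightarrow> real) \<Rightarrow> latent \<times> real \<Rightarrow> latent \<Rightarrow> real" where
  "one_deviation L s2 u v \<mu> a = (\<lambda>(s, e) r. latent_mean \<mu> a r +
     (if r = s then e * sqrt (real (card L) * (s2 * latent_variance u v r)) else 0))"

definition one_deviation_pmf ::
  "latent set \<Rightarrow> real \<Rightarrow> real \<Rightarrow> real \<Rightarrow> real \<Rightarrow> (nat \<Rightarrow> real) \<Rightarrow> (latent \<Rightarrow> real) pmf" where
  "one_deviation_pmf L s2 u v \<mu> a =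
     map_pmf (one_deviation L s2 u v \<mu> a) (pmf_of_set (L \<times> {1, -1}))"

lemma integral_one_deviation_pmf:
  assumes "finite L" "L \<noteq> {}"
  shows "integral\<^sup>L (one_deviation_pmf L s2 u v \<mu> a) f =
    (\<Sum>s\<in>L. f (one_deviation L s2 u v \<mu> a (s, 1)) + f (one_deviation L s2 u v \<mu> a (s, -1)))
      / (2 * real (card L))"
  using assms
  by (simp add: one_deviation_pmf_def integral_pmf_of_set sum.cartesian_product'
      card_cartesian_product mult.commute)

lemma expectation_one_deviation_pmf:
  assumes "finite L" "L \<noteq> {}"
  shows "integral\<^sup>L (one_deviation_pmf L s2 u v \<mu> a) (\<lambda>\<omega>. \<omega> r) = latent_mean \<mu> a r"
proof -
  have "(\<Sum>s\<in>L. one_deviation L s2 u v \<mu> a (s, 1) r + one_deviation L s2 u v \<mu> a (s, -1) r)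
      = (\<Sum>s\<in>L. 2 * latent_mean \<mu> a r)"
    by (intro sum.cong refl) (simp add: one_deviation_def)
  then show ?thesis
    using assms by (simp add: integral_one_deviation_pmf)
qed

lemma covariance_one_deviation_pmf:
  assumes L: "finite L" and r: "r \<in> L" and nonneg: "s2 * latent_variance u v r \<ge> 0"
  shows "covariance (one_deviation_pmf L s2 u v \<mu> a) (\<lambda>\<omega>. \<omega> r) (\<lambda>\<omega>. \<omega> r') =
    (if r = r' then s2 * latent_variance u v r else 0)"
proof -
  have ne: "L \<noteq> {}"
    using r by auto
  have "covariance (one_deviation_pmf L s2 u v \<mu> a) (\<lambda>\<omega>. \<omega> r) (\<lambda>\<omega>. \<omega> r') =
      (\<Sum>s\<in>L. if s = r then (if r = r' then 2 * (real (card L) * (s2 * latent_variance u v r)) else 0)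
        else 0) / (2 * real (card L))"
    unfolding covariance_def expectation_one_deviation_pmf[OF L ne]
      integral_one_deviation_pmf[OF L ne]
    using nonneg
    by (intro arg_cong2[of _ _ _ _ "(/)"] sum.cong refl) (auto simp: one_deviation_def)
  also have "\<dots> = (if r = r' then s2 * latent_variance u v r else 0)"
    using L r ne by (simp add: sum.delta)
  finally show ?thesis .
qed

lemma multiple_group_rcr_one_deviation_pmf:
  assumes "J \<ge> 2" "K \<ge> 1" "n \<ge> 1" "(J - 1) * n < N" and pos: "s2 > 0" "u > 0" "v > 0"
  shows "multiple_group_rcr J N K n s2 u v
    (\<lambda>\<mu> a. one_deviation_pmf (latents J N K n) s2 u v \<mu> a) (\<lambda>r \<omega>. \<omega> r)"
proof -
  let ?L = "latents J N K n"
  have "Mu N \<in> ?L"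
    using assms by (auto simp: latents_def)
  then have ne: "?L \<noteq> {}"
    by auto
  have nonneg: "s2 * latent_variance u v r \<ge> 0" for r
    using pos by (cases r) auto
  have finite_support: "finite (set_pmf (one_deviation_pmf ?L s2 u v \<mu> a))" for \<mu> a
    using ne by (simp add: one_deviation_pmf_def finite_latents)
  note mean = expectation_one_deviation_pmf[OF finite_latents ne]
  note cov = covariance_one_deviation_pmf[OF finite_latents _ nonneg]
  show ?thesis
    using assms
    by unfold_locales
       (auto simp: mean cov mult.commute intro: integrable_measure_pmf_finite finite_support
         measure_pmf.prob_space_axioms)
qed

lemma A_exact_eq_trace_formula:
  assumes "J \<ge> 2" "K \<ge> 1" "n \<ge> 1" "m \<ge> 1" "s2 > 0" "u > 0" "v > 0"
  shows "A_exact J ((J - 1) * n + m) K n s2 u v = trace_formula J K s2 u v (real n) (real m)"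
proof -
  let ?N = "(J - 1) * n + m"
  have model: "multiple_group_rcr J ?N K n s2 u v
      (\<lambda>\<mu> a. one_deviation_pmf (latents J ?N K n) s2 u v \<mu> a) (\<lambda>r \<omega>. \<omega> r)"
    using assms by (intro multiple_group_rcr_one_deviation_pmf) auto
  have m: "?N - (J - 1) * n = m"
    by simp
  show ?thesis
    unfolding A_exact_def
  proof (rule the_equality)
    show "\<exists>(P :: real \<Rightarrow> (nat \<Rightarrow> real) \<Rightarrow> (latent \<Rightarrow> real) measure) X H \<mu> a.
        multiple_group_rcr J ?N K n s2 u v P X \<and> is_Psi_BLUP J ?N K n P X H \<and>
        trace_formula J K s2 u v (real n) (real m) = error_trace J ?N (P \<mu> a) X H"
      using model multiple_group_rcr.is_Psi_BLUP_effect_predictor[OF model]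
        multiple_group_rcr.trace_effect_predictor[OF model, unfolded m]
      by metis
  next
    fix t
    assume "\<exists>(P :: real \<Rightarrow> (nat \<Rightarrow> real) \<Rightarrow> (latent \<Rightarrow> real) measure) X H \<mu> a.
        multiple_group_rcr J ?N K n s2 u v P X \<and> is_Psi_BLUP J ?N K n P X H \<and>
        t = error_trace J ?N (P \<mu> a) X H"
    then show "t = trace_formula J K s2 u v (real n) (real m)"
      by (auto simp: multiple_group_rcr.error_trace_eq_trace_formula)
  qed
qed


section \<open>Rational functions of two variables\<close>

lemma poly2_mult: "poly2 (p * q) x y = poly2 p x y * poly2 q x y"
  by (simp add: poly2_def)

lemma poly2_add: "poly2 (p + q) x y = poly2 p x y + poly2 q x y"
  by (simp add: poly2_def)

lemma poly2_diff: "poly2 (p - q) x y = poly2 p x y - poly2 q x y"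
  by (simp add: poly2_def)

lemma infinite_positive_integers: "infinite (real ` {1..})"
  by (simp add: finite_image_iff infinite_Ici)

text \<open>For each positive integer \<open>m\<close>, substituting the constant \<open>[:m:]\<close> for the outer variable gives
  a polynomial with infinitely many roots, so \<open>[:m:]\<close> is a root of \<open>p\<close>. Over the integral domain of
  real polynomials, \<open>p\<close> cannot have infinitely many roots either, unless it is zero.\<close>

lemma poly2_eq_0_if_zero_on_grid:
  assumes "\<And>n m :: nat. n \<ge> 1 \<Longrightarrow> m \<ge> 1 \<Longrightarrow> poly2 p (real n) (real m) = 0"
  shows "p = 0"
proof (rule ccontr)
  assume "p \<noteq> 0"
  have "poly p [:real m:] = 0" if "m \<ge> 1" for m :: nat
  proof (rule ccontr)
    assume "poly p [:real m:] \<noteq> 0"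
    then have "finite {x. poly (poly p [:real m:]) x = 0}"
      by (rule poly_roots_finite)
    moreover have "real ` {1..} \<subseteq> {x. poly (poly p [:real m:]) x = 0}"
      using assms that by (auto simp: poly2_def)
    ultimately show False
      using infinite_positive_integers finite_subset by blast
  qed
  then have "(\<lambda>c. [:c:]) ` real ` {1..} \<subseteq> {y. poly p y = 0}"
    by auto
  moreover have "infinite ((\<lambda>c. [:c:]) ` real ` {1..})"
    using infinite_positive_integers by (simp add: finite_image_iff inj_on_def)
  ultimately show False
    using poly_roots_finite[OF \<open>p \<noteq> 0\<close>] finite_subset by blast
qed

lemma rational_function2_eqI:
  assumes "rational_function2 F" "rational_function2 G"
    and grid: "\<And>n m :: nat. n \<ge> 1 \<Longrightarrow> m \<ge> 1 \<Longrightarrow> F (real n) (real m) = G (real n) (real m)"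
    and "x > 0" "y > 0"
  shows "F x y = G x y"
proof -
  obtain p q where F: "\<And>x y. x > 0 \<Longrightarrow> y > 0 \<Longrightarrow> poly2 q x y \<noteq> 0 \<and> F x y = poly2 p x y / poly2 q x y"
    using assms(1) by (auto simp: rational_function2_def)
  obtain p' q' where G: "\<And>x y. x > 0 \<Longrightarrow> y > 0 \<Longrightarrow> poly2 q' x y \<noteq> 0 \<and> G x y = poly2 p' x y / poly2 q' x y"
    using assms(2) by (auto simp: rational_function2_def)
  have "poly2 (p * q' - p' * q) (real n) (real m) = 0" if "n \<ge> 1" "m \<ge> 1" for n m :: nat
    using grid[OF that] F[of "real n" "real m"] G[of "real n" "real m"] that
    by (simp add: poly2_mult poly2_diff frac_eq_eq)
  then have "p * q' - p' * q = 0"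
    by (rule poly2_eq_0_if_zero_on_grid)
  then have "poly2 (p * q' - p' * q) x y = 0"
    by (simp add: poly2_def)
  then show ?thesis
    using F[of x y] G[of x y] assms by (simp add: poly2_mult poly2_diff frac_eq_eq)
qed

lemma rational_function2_trace_formula:
  "rational_function2 (trace_formula J K s2 u v)"
proof -
  \<comment> \<open>\<open>x\<close> and \<open>y\<close> are the two variables: \<open>poly2\<close> substitutes its last argument for the outer one.\<close>
  define x y :: "real poly poly" where "x = [:[:0, 1:]:]" and "y = [:0, 1:]"
  define C :: "real \<Rightarrow> real poly poly" where "C = (\<lambda>c. [:[:c:]:])"
  have var: "poly2 x a b = a" "poly2 y a b = b" "poly2 (C c) a b = c" for a b c
    by (simp_all add: poly2_def x_def y_def C_def)
  define p where "p = C (s2 * (real J - 1)) *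
     ((C (real J - 1) * x + y) * (C (u + v + 1 / real K) * y + C (u + 1 / real K) * x + C v * x * y)
      - (C (2 * v) + C (v\<^sup>2 / (u + v + 1 / real K)) * (x - C 1)) * x * y)"
  have p: "poly2 p a b = s2 * (real J - 1) *
     (((real J - 1) * a + b) * ((u + v + 1 / real K) * b + (u + 1 / real K) * a + v * a * b)
      - (2 * v + v\<^sup>2 / (u + v + 1 / real K) * (a - 1)) * a * b)" for a b
    unfolding p_def poly2_mult poly2_diff poly2_add var by (rule refl)
  have q: "poly2 (x * y) a b = a * b" for a b
    by (simp add: poly2_mult var)
  have "trace_formula J K s2 u v a b = poly2 p a b / poly2 (x * y) a b" if "a > 0" "b > 0" for a b
  proof -
    have "s * (l * (c / a + d / b + v) - 2 * v - r * (a - 1)) =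
      s * (l * (c * b + d * a + v * a * b) - (2 * v + r * (a - 1)) * a * b) / (a * b)"
      for s l c d r
      using that by (simp add: field_simps)
    then show ?thesis
      unfolding p q trace_formula_def .
  qed
  then show ?thesis
    unfolding rational_function2_def using q by (metis mult_eq_0_iff less_irrefl)
qed


section \<open>The criterion of an approximate design\<close>

lemma A_Psi_eq_trace_formula:
  assumes "J \<ge> 2" "N \<ge> 1" "K \<ge> 1" "s2 > 0" "u > 0" "v > 0"
    and "0 < w" "w < 1 / (real J - 1)"
  shows "A_Psi J N K s2 u v w =
    trace_formula J K s2 u v (real N * w) (real N * (1 - (real J - 1) * w))"
proof -
  have pos: "real N * w > 0" "real N * (1 - (real J - 1) * w) > 0"
  proof -
    have "(real J - 1) * w < 1"
      using assms by (simp add: field_simps)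
    then show "real N * w > 0" "real N * (1 - (real J - 1) * w) > 0"
      using assms by simp_all
  qed
  have ext: "extends_A_exact J K s2 u v (trace_formula J K s2 u v)"
    unfolding extends_A_exact_def
    using assms
    by (intro conjI allI impI rational_function2_trace_formula A_exact_eq_trace_formula[symmetric])
  show ?thesis
    unfolding A_Psi_def
  proof (rule the_equality)
    show "\<exists>F. extends_A_exact J K s2 u v F \<and>
      trace_formula J K s2 u v (real N * w) (real N * (1 - (real J - 1) * w)) =
        F (real N * w) (real N * (1 - (real J - 1) * w))"
      using ext by (intro exI[of _ "trace_formula J K s2 u v"] conjI refl)
  next
    fix t
    assume "\<exists>F. extends_A_exact J K s2 u v F \<and>
      t = F (real N * w) (real N * (1 - (real J - 1) * w))"
    then obtain F where F: "extends_A_exact J K s2 u v F"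
      and t: "t = F (real N * w) (real N * (1 - (real J - 1) * w))"
      by blast
    show "t = trace_formula J K s2 u v (real N * w) (real N * (1 - (real J - 1) * w))"
      unfolding t
      by (rule rational_function2_eqI)
        (use F ext pos in \<open>simp_all add: extends_A_exact_def\<close>)
  qed
qed

lemma trace_formula_design:
  assumes "N \<ge> 1" "K \<ge> 1" "u > 0" "v > 0" "0 < w" "(real J - 1) * w < 1"
  shows "trace_formula J K s2 u v (real N * w) (real N * (1 - (real J - 1) * w)) =
    s2 * (real J - 1) *
      ((real K * (v + u) + 1) / (real K * w)
       + (real K * u + 1) / (real K * (1 - (real J - 1) * w))
       + v * (real N - 2 - real K * v * (real N * w - 1) / (real K * (v + u) + 1)))"
proof -
  define z where "z = 1 - (real J - 1) * w"
  define D where "D = real K * (v + u) + 1"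
  have z: "z > 0"
    using assms by (simp add: z_def)
  have "D > 0"
    using assms by (simp add: D_def add_nonneg_pos)
  have total: "(real J - 1) * (real N * w) + real N * z = real N"
    by (simp add: z_def algebra_simps)
  have D: "u + v + 1 / real K = D / real K"
    using assms by (simp add: D_def field_simps)
  have K: "u + 1 / real K = (real K * u + 1) / real K"
    using assms by (simp add: field_simps)
  have "real N * (D / real K / (real N * w) + (real K * u + 1) / real K / (real N * z) + v)
      - 2 * v - v\<^sup>2 / (D / real K) * (real N * w - 1)
    = D / (real K * w) + (real K * u + 1) / (real K * z)
      + v * (real N - 2 - real K * v * (real N * w - 1) / D)"
    using assms z \<open>D > 0\<close> by (simp add: field_simps power2_eq_square)
  then show ?thesis
    unfolding trace_formula_def z_def[symmetric] D_def[symmetric] total D K by simp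
qed

theorem theorem7:
  fixes J N K :: nat and s2 u v :: real
  assumes "J \<ge> 2" and "N \<ge> 1" and "K \<ge> 1" and "s2 > 0" and "u > 0" and "v > 0"
  shows "(\<forall>w :: real. 0 < w \<and> w < 1 / (real J - 1) \<longrightarrow>
       A_Psi J N K s2 u v w = s2 * (real J - 1) *
         ((real K * (v + u) + 1) / (real K * w)
          + (real K * u + 1) / (real K * (1 - (real J - 1) * w))
          + v * (real N - 2 - real K * v * (real N * w - 1) / (real K * (v + u) + 1))))
    \<and> (\<forall>(n :: nat) (P :: real \<Rightarrow> (nat \<Rightarrow> real) \<Rightarrow> 'a measure) X.
         multiple_group_rcr J N K n s2 u v P X \<longrightarrow>
           (\<exists>H. is_Psi_BLUP J N K n P X H) \<and>
           (\<forall>H \<mu> a. is_Psi_BLUP J N K n P X H \<longrightarrow>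
              error_trace J N (P \<mu> a) X H = A_Psi J N K s2 u v (real n / real N)))"
proof (intro conjI allI impI)
  fix w :: real
  assume w: "0 < w \<and> w < 1 / (real J - 1)"
  then have "(real J - 1) * w < 1"
    using assms by (simp add: field_simps)
  then show "A_Psi J N K s2 u v w = s2 * (real J - 1) *
      ((real K * (v + u) + 1) / (real K * w)
       + (real K * u + 1) / (real K * (1 - (real J - 1) * w))
       + v * (real N - 2 - real K * v * (real N * w - 1) / (real K * (v + u) + 1)))"
    using assms w by (simp add: A_Psi_eq_trace_formula trace_formula_design)
next
  fix n and P :: "real \<Rightarrow> (nat \<Rightarrow> real) \<Rightarrow> 'a measure" and X
  assume model: "multiple_group_rcr J N K n s2 u v P X"
  interpret multiple_group_rcr J N K n s2 u v P X
    by (rule model)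
  show "\<exists>H. is_Psi_BLUP J N K n P X H"
    using is_Psi_BLUP_effect_predictor by blast
  fix H \<mu> a
  assume H: "is_Psi_BLUP J N K n P X H"
  have J: "real (J - 1) = real J - 1"
    using J_ge_2 by (simp add: of_nat_diff)
  have less: "(real J - 1) * real n < real N"
    using control_nonempty unfolding J[symmetric] of_nat_mult[symmetric] of_nat_less_iff .
  then have w: "0 < real n / real N" "real n / real N < 1 / (real J - 1)"
    using J_ge_2 n_ge_1 assms(2) by (simp_all add: field_simps)
  have "real (N - (J - 1) * n) = real N - (real J - 1) * real n"
    unfolding of_nat_diff[OF less_imp_le[OF control_nonempty]] of_nat_mult J ..
  moreover have "real N * (1 - (real J - 1) * (real n / real N)) = real N - (real J - 1) * real n"
    using assms(2) by (simp add: right_diff_distrib)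
  ultimately have "real N * (real n / real N) = real n"
    "real N * (1 - (real J - 1) * (real n / real N)) = real (N - (J - 1) * n)"
    using assms(2) by simp_all
  then show "error_trace J N (P \<mu> a) X H = A_Psi J N K s2 u v (real n / real N)"
    using assms w error_trace_eq_trace_formula[OF H] by (simp only: A_Psi_eq_trace_formula)
qed

end
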